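(* Let $r,t,c$ be positive integers with $r\ge 2$ and $t\ge c\ge 1$. Let $a(r,c)=\left(r^r+1-\frac1r\right)(c-1)$. Let $T$ be a tight $r$-tree with $t$ edges and $c(T)\le c$. If $G$ is an $r$-graph that does not contain $T$, then $$e(G)\le\left(\frac{t-1}{r}+a(r,c)\right)|\partial(G)|.$$
   Context: An $r$-graph is a (finite) $r$-uniform hypergraph; $e(G)$ is the number of edges of $G$. The shadow of an $r$-graph $G$ is $\partial(G)=\{S: |S|=r-1,\ S\subseteq e\text{ for some }e\in E(G)\}$. An $r$-graph $T$ is a tight $r$-tree if its edges can be ordered as $e_1,\dots,e_t$ so that: ( * ) for each $i\ge 2$ there are a vertex $v\in e_i$ and an index $1\le s\le i-1$ such that $v\notin\bigcup_{j=1}^{i-1}e_j$ and $e_i\setminus\{v\}\subset e_s$. The vertex set of a tight tree is the union of its edges. Given a tight $r$-tree $T$ and a tight subtree $T'$ of $T$ (a subgraph of $T$ that is itself a tight $r$-tree), $T'$ is a trunk of $T$ if there is an ordering of the edges of $T$ satisfying ( * ) in which the edges of $T'$ are listed first, and for each $e\in E(T)\setminus E(T')$ there exists $e'\in E(T')$ with $|e\cap e'|=r-1$. $c(T)$ denotes the minimum number of edges in a trunk of $T$. An $r$-graph $G$ contains $T$ if there is an injection $V(T)\to V(G)$ mapping every edge of $T$ to an edge of $G$. *)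

theory Defs
  imports Complex_Main
begin

definition r_graph :: "nat \<Rightarrow> 'a set \<Rightarrow> 'a set set \<Rightarrow> bool" where
  "r_graph r V E \<longleftrightarrow> finite V \<and> (\<forall>e\<in>E. e \<subseteq> V \<and> card e = r)"

definition shadow :: "nat \<Rightarrow> 'a set set \<Rightarrow> 'a set set" where
  "shadow r E = {S. card S = r - 1 \<and> (\<exists>e\<in>E. S \<subseteq> e)}"

text \<open>Edge orderings are lists, indexed from 0, so the growth condition applies
  to every index except 0.\<close>

definition tight_ordering :: "'a set set \<Rightarrow> 'a set list \<Rightarrow> bool" where
  "tight_ordering T es \<longleftrightarrow> distinct es \<and> set es = T \<and>
     (\<forall>i. 1 \<le> i \<and> i < length es \<longrightarrow>
        (\<exists>v\<in>es ! i. \<exists>s<i. v \<notin> (\<Union>j<i. es ! j) \<and> es ! i - {v} \<subseteq> es ! s))"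

text \<open>Since the vertex set of a tight tree is the union of its edges, a tight tree is
  represented by its edge set alone. It has at least one edge.\<close>

definition tight_tree :: "nat \<Rightarrow> 'a set set \<Rightarrow> bool" where
  "tight_tree r T \<longleftrightarrow> T \<noteq> {} \<and> r_graph r (\<Union>T) T \<and> (\<exists>es. tight_ordering T es)"

definition trunk :: "nat \<Rightarrow> 'a set set \<Rightarrow> 'a set set \<Rightarrow> bool" where
  "trunk r T T' \<longleftrightarrow> T' \<subseteq> T \<and> tight_tree r T' \<and>
     (\<exists>es. tight_ordering T es \<and> set (take (card T') es) = T') \<and>
     (\<forall>e\<in>T - T'. \<exists>e'\<in>T'. card (e \<inter> e') = r - 1)"

text \<open>The minimum exists for every tight tree, which is a trunk of itself.\<close>

definition trunk_number :: "nat \<Rightarrow> 'a set set \<Rightarrow> nat" where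
  "trunk_number r T = (LEAST k. \<exists>T'. trunk r T T' \<and> card T' = k)"

definition contains :: "'a set \<Rightarrow> 'a set set \<Rightarrow> 'b set set \<Rightarrow> bool" where
  "contains V E T \<longleftrightarrow>
     (\<exists>f. inj_on f (\<Union>T) \<and> f ` (\<Union>T) \<subseteq> V \<and> (\<forall>e\<in>T. f ` e \<in> E))"

definition a_const :: "nat \<Rightarrow> nat \<Rightarrow> real" where
  "a_const r c = (real r ^ r + 1 - 1 / real r) * (real c - 1)"

lemma trunk_self: "tight_tree r T \<Longrightarrow> trunk r T T"
  unfolding trunk_def tight_tree_def tight_ordering_def
  by (auto simp: distinct_card)

end

(* Let c be the number of edges of a smallest trunk and set
   beta = (t-1)/r + (1-1/r)(c-1). Giving an edge e the weight sum_{x in e} 1/d(e-x), the total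
   weight is |shadow|, so if E is too large then more than r^r (c-1) |shadow| edges are light,
   i.e. have weight below 1/beta. Sorting the codegrees d_1 <= ... <= d_r of a light edge gives
   d_i > i beta. For a random r-colouring of the vertices, a light edge has its vertices coloured
   by the rank of the opposite codegree with probability r^(-r); hence for some colouring more than
   (c-1) |shadow| light edges are so coloured, and some of them form a subgraph of positive
   codegrees at least c. The trunk embeds there with any prescribed matching of its r colour
   classes to the ranks. Order the colour classes of T by their number of leaves: the leaves of the
   first i classes number at most i(t-c)/r <= i beta - (c-1), so the leaves can be added greedily,
   class by class. *)

theory Submission
  imports Defs "HOL-Library.FuncSet"
begin

section \<open>Codegrees and the shadow\<close>

definition codegree :: "'a set set \<Rightarrow> 'a set \<Rightarrow> nat" where
  "codegree E S = card {e \<in> E. S \<subseteq> e}"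

lemma r_graph_finite:
  assumes "r_graph r V E"
  shows "finite E" "finite (shadow r E)"
proof -
  have V: "finite V" "\<And>e. e \<in> E \<Longrightarrow> e \<subseteq> V"
    using assms by (auto simp: r_graph_def)
  have "E \<subseteq> Pow V" "shadow r E \<subseteq> Pow V"
    using V(2) by (auto simp: shadow_def dest!: V(2))
  then show "finite E" "finite (shadow r E)"
    using V(1) by (meson finite_Pow_iff finite_subset)+
qed

lemma shadow_mono: "E \<subseteq> E' \<Longrightarrow> shadow r E \<subseteq> shadow r E'"
  by (auto simp: shadow_def)

lemma shadow_Diff_singleton:
  assumes "e \<in> E" "card e = r" "x \<in> e"
  shows "e - {x} \<in> shadow r E"
  using assms by (auto simp: shadow_def card_Diff_singleton)

lemma codegree_pos:
  assumes "finite E" "e \<in> E" "S \<subseteq> e"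
  shows "codegree E S > 0"
  using assms by (auto simp: codegree_def card_gt_0_iff)

lemma subset_eq_Diff_singleton:
  assumes "finite e" "S \<subseteq> e" "card e = r" "card S = r - 1" "r \<ge> 1"
  obtains x where "x \<in> e" "x \<notin> S" "S = e - {x}"
proof -
  have "card (e - S) = 1"
    using assms by (simp add: card_Diff_subset finite_subset)
  then obtain x where "e - S = {x}" by (auto simp: card_1_singleton_iff)
  then show thesis using that[of x] assms(2) by blast
qed

text \<open>Double counting: after exchanging the sums, a shadow set \<open>S\<close> contributes
  \<open>1 / codegree E S\<close> once for each edge containing it, hence at most 1 in
  total.\<close>

lemma sum_inverse_codegree_le:
  assumes "r_graph r V E" "r \<ge> 1"
  shows "(\<Sum>e\<in>E. \<Sum>x\<in>e. 1 / real (codegree E (e - {x}))) \<le> real (card (shadow r E))"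
proof -
  note fin = r_graph_finite[OF assms(1)]
  have E: "\<And>e. e \<in> E \<Longrightarrow> card e = r \<and> finite e"
    using assms(1) by (auto simp: r_graph_def intro: finite_subset)
  have "(\<Sum>x\<in>e. 1 / real (codegree E (e - {x}))) =
      (\<Sum>S | S \<in> shadow r E \<and> S \<subseteq> e. 1 / real (codegree E S))" if e: "e \<in> E" for e
  \<comment> \<open>The vertices of an edge correspond to its (\<open>r - 1\<close>)-subsets by
    deletion, which turns a sum over vertices into one over shadow sets.\<close>
  proof (rule sum.reindex_bij_betw)
    show "bij_betw (\<lambda>x. e - {x}) e {S. S \<in> shadow r E \<and> S \<subseteq> e}"
    proof (rule bij_betwI')
      fix S assume "S \<in> {S. S \<in> shadow r E \<and> S \<subseteq> e}"
      then have "S \<subseteq> e" "card S = r - 1" by (auto simp: shadow_def)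
      then show "\<exists>x\<in>e. S = e - {x}"
        using subset_eq_Diff_singleton[of e S r] E[OF e] assms(2) by metis
    qed (use E[OF e] shadow_Diff_singleton[OF e] in auto)
  qed
  then have "(\<Sum>e\<in>E. \<Sum>x\<in>e. 1 / real (codegree E (e - {x}))) =
      (\<Sum>e\<in>E. \<Sum>S | S \<in> shadow r E \<and> S \<subseteq> e. 1 / real (codegree E S))"
    by simp
  also have "\<dots> = (\<Sum>S\<in>shadow r E. \<Sum>e | e \<in> E \<and> S \<subseteq> e. 1 / real (codegree E S))"
    by (rule sum.swap_restrict) (use fin in auto)
  also have "\<dots> \<le> (\<Sum>S\<in>shadow r E. 1)"
    by (rule sum_mono) (simp add: codegree_def)
  finally show ?thesis by simp
qed

text \<open>Deleting all edges through a shadow set of codegree at most \<open>k\<close> costs at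
  most \<open>k\<close> edges and removes at least that set from the shadow, so the strict
  inequality survives. It also keeps the edge set nonempty until the process stops.\<close>

lemma exists_dense_subgraph:
  assumes "finite H" "finite (shadow r H)" "card H > k * card (shadow r H)"
  shows "\<exists>H'\<subseteq>H. H' \<noteq> {} \<and> (\<forall>S\<in>shadow r H'. codegree H' S > k)"
  using assms
proof (induction "card H" arbitrary: H rule: less_induct)
  case less
  show ?case
  proof (cases "\<forall>S\<in>shadow r H. codegree H S > k")
    case True
    then show ?thesis using less.prems by (intro exI[of _ H]) auto
  next
    case False
    then obtain S where S: "S \<in> shadow r H" "codegree H S \<le> k" by (meson not_less)
    define D where "D = {e\<in>H. S \<subseteq> e}"
    have D: "D \<subseteq> H" "D \<noteq> {}" "card D \<le> k"
      using S by (auto simp: D_def codegree_def shadow_def)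
    have lt: "card (H - D) < card H"
      using D less.prems(1) by (intro psubset_card_mono) auto
    have sub: "shadow r (H - D) \<subseteq> shadow r H - {S}"
      by (auto simp: shadow_def D_def)
    have fin: "finite (shadow r (H - D))"
      by (rule finite_subset[OF sub]) (use less.prems in auto)
    have "card (shadow r (H - D)) \<le> card (shadow r H) - 1"
      using card_mono[OF _ sub] less.prems S(1) by simp
    moreover have "card (shadow r H) \<ge> 1"
      using S(1) less.prems by (metis One_nat_def Suc_leI card_gt_0_iff empty_iff)
    ultimately have "card (shadow r (H - D)) + 1 \<le> card (shadow r H)" by linarith
    then have "k * (card (shadow r (H - D)) + 1) \<le> k * card (shadow r H)"
      by (rule mult_le_mono2)
    moreover have "card (H - D) = card H - card D"
      using D less.prems by (meson card_Diff_subset finite_subset)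
    ultimately have "card (H - D) > k * card (shadow r (H - D))"
      using less.prems(3) D(3) by (simp add: algebra_simps)
    then obtain H' where "H' \<subseteq> H - D" "H' \<noteq> {}" "\<forall>S\<in>shadow r H'. codegree H' S > k"
      using less.hyps[OF lt _ fin] less.prems(1) by blast
    then show ?thesis by blast
  qed
qed

section \<open>Ranking the vertices of a light edge\<close>

text \<open>Ranks start at 0 and ties are broken arbitrarily, so that \<open>\<tau>\<close> is a
  bijection. It ranks the vertices of an edge by opposite codegree and, later, the colour classes of
  the tree by number of leaves.\<close>

lemma exists_sorting_bij:
  fixes f :: "'c \<Rightarrow> 'd::linorder"
  assumes "finite A"
  shows "\<exists>\<tau>. bij_betw \<tau> A {..<card A} \<and> (\<forall>u\<in>A. \<forall>v\<in>A. \<tau> u \<le> \<tau> v \<longrightarrow> f u \<le> f v)"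
proof -
  obtain xs where xs: "distinct xs" "set xs = A"
    using finite_distinct_list[OF assms] by blast
  define ys where "ys = sort_key f xs"
  have ys: "distinct ys" "set ys = A" "sorted (map f ys)" "length ys = card A"
    using xs by (auto simp: ys_def distinct_card[symmetric])
  have b: "bij_betw ((!) ys) {..<card A} A"
    using bij_betw_nth[OF ys(1)] ys by simp
  define \<tau> where "\<tau> = inv_into {..<card A} ((!) ys)"
  have \<tau>: "bij_betw \<tau> A {..<card A}" unfolding \<tau>_def by (rule bij_betw_inv_into[OF b])
  have nth: "ys ! \<tau> u = u" "\<tau> u < card A" if "u \<in> A" for u
    using bij_betw_inv_into_right[OF b that] bij_betwE[OF \<tau>] that by (auto simp: \<tau>_def)
  have "f u \<le> f v" if "u \<in> A" "v \<in> A" "\<tau> u \<le> \<tau> v" for u v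
    using sorted_nth_mono[OF ys(3) that(3)] nth[OF that(1)] nth[OF that(2)] ys(4) by simp
  then show ?thesis using \<tau> by blast
qed

lemma card_Collect_le_bij:
  assumes "bij_betw \<tau> A {..<r::nat}" "v \<in> A"
  shows "card {u \<in> A. \<tau> u \<le> \<tau> v} = \<tau> v + 1"
proof -
  have "\<tau> ` {u \<in> A. \<tau> u \<le> \<tau> v} = {..\<tau> v}"
  proof (intro equalityI subsetI)
    fix i assume "i \<in> {..\<tau> v}"
    moreover from this have "i < r" using bij_betwE[OF assms(1)] assms(2) by fastforce
    then have "i \<in> \<tau> ` A" using assms(1) by (simp add: bij_betw_def)
    ultimately show "i \<in> \<tau> ` {u \<in> A. \<tau> u \<le> \<tau> v}" by auto
  qed auto
  moreover have "inj_on \<tau> {u \<in> A. \<tau> u \<le> \<tau> v}"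
    using assms by (auto simp: bij_betw_def intro: inj_on_subset)
  ultimately show ?thesis by (metis card_image card_atMost Suc_eq_plus1)
qed

text \<open>The \<open>\<tau> x + 1\<close> vertices ranked no higher than \<open>x\<close> each
  contribute at least \<open>1 / d x\<close> to the weight of the edge. Lightness is stated as a
  product because \<open>\<beta>\<close> may be 0.\<close>

lemma light_edge_labelling:
  assumes "finite e" "card e = r"
    and pos: "\<And>x. x \<in> e \<Longrightarrow> d x > 0"
    and light: "\<beta> * (\<Sum>x\<in>e. 1 / real (d x)) < 1" and "\<beta> \<ge> 0"
  shows "\<exists>\<tau>. bij_betw \<tau> e {..<r} \<and> (\<forall>x\<in>e. (real (\<tau> x) + 1) * \<beta> < real (d x))"
proof -
  obtain \<tau> where \<tau>: "bij_betw \<tau> e {..<r}"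
    and mono: "\<And>u v. u \<in> e \<Longrightarrow> v \<in> e \<Longrightarrow> \<tau> u \<le> \<tau> v \<Longrightarrow> d u \<le> d v"
    using exists_sorting_bij[OF assms(1), of d] assms(2) by blast
  have "(real (\<tau> x) + 1) * \<beta> < real (d x)" if x: "x \<in> e" for x
  proof -
    have "(real (\<tau> x) + 1) / real (d x) = (\<Sum>u | u \<in> e \<and> \<tau> u \<le> \<tau> x. 1 / real (d x))"
      using card_Collect_le_bij[OF \<tau> x] by simp
    also have "\<dots> \<le> (\<Sum>u | u \<in> e \<and> \<tau> u \<le> \<tau> x. 1 / real (d u))"
      using mono x pos by (intro sum_mono divide_left_mono) auto
    also have "\<dots> \<le> (\<Sum>u\<in>e. 1 / real (d u))"
      using assms(1) by (intro sum_mono2) auto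
    finally have "\<beta> * ((real (\<tau> x) + 1) / real (d x)) \<le> \<beta> * (\<Sum>u\<in>e. 1 / real (d u))"
      using \<open>\<beta> \<ge> 0\<close> by (rule mult_left_mono)
    then have "\<beta> * ((real (\<tau> x) + 1) / real (d x)) < 1" using light by linarith
    then show ?thesis using pos[OF x] by (simp add: field_simps)
  qed
  then show ?thesis using \<tau> by blast
qed

section \<open>Averaging over vertex colourings\<close>

text \<open>This derandomizes the uniform colouring of \<open>V\<close>: an edge agrees with a
  fraction \<open>1 / r ^ r\<close> of all colourings, so some colouring does at least as well as
  the average.\<close>

lemma exists_agreeing_colouring:
  fixes \<tau> :: "'a set \<Rightarrow> 'a \<Rightarrow> nat"
  assumes "finite V" "finite L"
    and L: "\<And>e. e \<in> L \<Longrightarrow> e \<subseteq> V \<and> card e = r \<and> \<tau> e ` e \<subseteq> {..<r}" and "r \<ge> 1"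
  shows "\<exists>col. card L \<le> r ^ r * card {e \<in> L. \<forall>v\<in>e. col v = \<tau> e v}"
proof (rule ccontr)
  assume "\<nexists>col. card L \<le> r ^ r * card {e \<in> L. \<forall>v\<in>e. col v = \<tau> e v}"
  then have less: "r ^ r * card {e \<in> L. \<forall>v\<in>e. col v = \<tau> e v} < card L" for col
    by (meson not_less)
  define P where "P = PiE V (\<lambda>_. {..<r})"
  have finP: "finite P" unfolding P_def by (rule finite_PiE) (use assms in auto)
  have cardP: "card P = r ^ card V" using assms(1) by (simp add: P_def card_PiE)
  have neP: "P \<noteq> {}"
    unfolding P_def using \<open>r \<ge> 1\<close> by (auto simp: PiE_eq_empty_iff lessThan_empty_iff)
  \<comment> \<open>Agreement fixes the \<open>r\<close> values on \<open>e\<close> and leaves the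
    others free. Multiplying by \<open>r ^ r\<close> keeps the count in the natural numbers.\<close>
  have agree: "r ^ r * card {p \<in> P. \<forall>v\<in>e. p v = \<tau> e v} = card P" if e: "e \<in> L" for e
  proof -
    have "{p \<in> P. \<forall>v\<in>e. p v = \<tau> e v} =
        PiE V (\<lambda>v. if v \<in> e then {\<tau> e v} else {..<r})"
    proof (intro set_eqI iffI)
      fix p assume p: "p \<in> PiE V (\<lambda>v. if v \<in> e then {\<tau> e v} else {..<r})"
      have "p v \<in> {..<r}" if "v \<in> V" for v
        using PiE_mem[OF p that] L[OF e] by (auto split: if_splits)
      moreover have "p v = \<tau> e v" if "v \<in> e" for v
        using PiE_mem[OF p, of v] that L[OF e] by auto
      ultimately show "p \<in> {p \<in> P. \<forall>v\<in>e. p v = \<tau> e v}"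
        using p by (auto simp: P_def PiE_iff)
    qed (auto simp: P_def PiE_iff)
    then have "card {p \<in> P. \<forall>v\<in>e. p v = \<tau> e v} =
        (\<Prod>v\<in>V. card (if v \<in> e then {\<tau> e v} else {..<r}))"
      using assms(1) by (simp add: card_PiE)
    also have "\<dots> = (\<Prod>v\<in>V - e. card (if v \<in> e then {\<tau> e v} else {..<r})) *
        (\<Prod>v\<in>e. card (if v \<in> e then {\<tau> e v} else {..<r}))"
      using assms(1) L[OF e] by (intro prod.subset_diff) auto
    also have "\<dots> = r ^ card (V - e)" by simp
    also have "card (V - e) = card V - r"
      using L[OF e] assms(1) by (metis card_Diff_subset finite_subset)
    finally show ?thesis
      using card_mono[of V e] L[OF e] assms(1) by (simp add: cardP flip: power_add)
  qed
  have "card L * card P = (\<Sum>e\<in>L. r ^ r * card {p \<in> P. \<forall>v\<in>e. p v = \<tau> e v})"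
    using agree by simp
  also have "\<dots> = r ^ r * (\<Sum>e\<in>L. \<Sum>p | p \<in> P \<and> (\<forall>v\<in>e. p v = \<tau> e v). 1)"
    by (simp add: sum_distrib_left)
  also have "\<dots> = r ^ r * (\<Sum>p\<in>P. \<Sum>e | e \<in> L \<and> (\<forall>v\<in>e. p v = \<tau> e v). 1)"
    by (subst sum.swap_restrict) (use finP assms(2) in auto)
  also have "\<dots> = (\<Sum>p\<in>P. r ^ r * card {e \<in> L. \<forall>v\<in>e. p v = \<tau> e v})"
    by (simp add: sum_distrib_left)
  also have "\<dots> < (\<Sum>p\<in>P. card L)"
    by (rule sum_strict_mono) (use finP neP less in auto)
  finally show False by simp
qed

section \<open>Greedy choice and averages of sorted sequences\<close>

text \<open>An element \<open>m\<close> of largest key chooses last: its hypothesis counts all of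
  \<open>M\<close>, so \<open>A m\<close> is larger than the set of values already taken. Dropping
  \<open>m\<close> can only lower the counts required of the others.\<close>

lemma greedy_choice:
  fixes key :: "'c \<Rightarrow> nat"
  assumes "finite M"
    and "\<And>e. e \<in> M \<Longrightarrow> finite (A e) \<and> card {e' \<in> M. key e' \<le> key e} \<le> card (A e)"
  shows "\<exists>g. inj_on g M \<and> (\<forall>e\<in>M. g e \<in> A e)"
  using assms
proof (induction "card M" arbitrary: M)
  case 0
  then show ?case by auto
next
  case (Suc n)
  then have "M \<noteq> {}" by auto
  then have "Max (key ` M) \<in> key ` M" using Suc.prems(1) by (intro Max_in) auto
  then obtain m where "m \<in> M" "Max (key ` M) = key m" by blast
  then have m: "m \<in> M" "\<And>e. e \<in> M \<Longrightarrow> key e \<le> key m"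
    using Suc.prems(1) Max_ge[of "key ` M"] by auto
  have "finite (A e) \<and> card {e' \<in> M - {m}. key e' \<le> key e} \<le> card (A e)" if "e \<in> M - {m}" for e
    using Suc.prems that card_mono[of "{e' \<in> M. key e' \<le> key e}" "{e' \<in> M - {m}. key e' \<le> key e}"]
    by (force intro: order_trans)
  moreover have "n = card (M - {m})" using Suc m by simp
  ultimately obtain g where g: "inj_on g (M - {m})" "\<forall>e\<in>M - {m}. g e \<in> A e"
    using Suc.hyps(1)[of "M - {m}"] Suc.prems(1) by blast
  have "{e' \<in> M. key e' \<le> key m} = M" using m by auto
  then have "card (g ` (M - {m})) < card (A m)"
    using Suc.prems(2)[OF m(1)] Suc.hyps(2) card_image_le[of "M - {m}" g] Suc.prems(1) m(1)
    by simp linarith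
  then obtain a where a: "a \<in> A m" "a \<notin> g ` (M - {m})"
    using Suc.prems(1) by (metis card_mono finite_Diff finite_imageI leD subsetI)
  have "inj_on (g(m := a)) M"
    using g(1) a(2) by (auto simp: inj_on_def)
  then show ?case using g(2) a(1) by (intro exI[of _ "g(m := a)"]) auto
qed

text \<open>The value \<open>n i\<close> separates the prefix of \<open>i + 1\<close> terms from the
  \<open>r - i - 1\<close> later ones, so the prefix average is at most the tail average and hence
  at most the overall average.\<close>

lemma sum_prefix_le_average:
  fixes n :: "nat \<Rightarrow> nat"
  assumes mono: "\<And>i j. i \<le> j \<Longrightarrow> j < r \<Longrightarrow> n i \<le> n j" and "i < r"
  shows "r * (\<Sum>j\<le>i. n j) \<le> (i + 1) * (\<Sum>j<r. n j)"
proof -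
  have split: "(\<Sum>j<r. n j) = (\<Sum>j\<le>i. n j) + (\<Sum>j\<in>{i<..<r}. n j)"
    using \<open>i < r\<close> by (subst sum.union_disjoint[symmetric]) (auto intro: sum.cong)
  have "(\<Sum>j\<le>i. n j) \<le> (i + 1) * n i"
    using sum_bounded_above[of "{..i}" n "n i"] mono \<open>i < r\<close> by simp
  then have "(r - i - 1) * (\<Sum>j\<le>i. n j) \<le> (r - i - 1) * ((i + 1) * n i)"
    by (rule mult_le_mono2)
  also have "\<dots> = (i + 1) * ((r - i - 1) * n i)" by (simp only: mult.left_commute)
  also have "(r - i - 1) * n i \<le> (\<Sum>j\<in>{i<..<r}. n j)"
    using sum_bounded_below[of "{i<..<r}" "n i" n] mono by simp
  then have "(i + 1) * ((r - i - 1) * n i) \<le> (i + 1) * (\<Sum>j\<in>{i<..<r}. n j)"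
    by (rule mult_le_mono2)
  finally have "(r - i - 1) * (\<Sum>j\<le>i. n j) \<le> (i + 1) * (\<Sum>j\<in>{i<..<r}. n j)" .
  moreover have "r = (r - i - 1) + (i + 1)" using \<open>i < r\<close> by simp
  then have "r * (\<Sum>j\<le>i. n j) = (r - i - 1) * (\<Sum>j\<le>i. n j) + (i + 1) * (\<Sum>j\<le>i. n j)"
    by (metis add_mult_distrib)
  ultimately show ?thesis by (simp only: split distrib_left)
qed

section \<open>Proper colourings of tight trees and coloured embeddings\<close>

text \<open>The other \<open>r - 1\<close> vertices use all colours but one. Since \<open>k\<close>
  is the same for all extensions \<open>f\<close>, the lemma serves both to choose a colour for
  \<open>v\<close> and to show that two colourings agree at \<open>v\<close>.\<close>

lemma missing_colour:
  assumes "finite e" "card e = r" "v \<in> e" "inj_on \<chi> (e - {v})" "\<chi> ` (e - {v}) \<subseteq> {..<r::nat}"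
  obtains k where "k < r" "\<And>f. (\<And>x. x \<in> e - {v} \<Longrightarrow> f x = \<chi> x) \<Longrightarrow> bij_betw f e {..<r} \<longleftrightarrow> f v = k"
proof -
  have r: "r \<ge> 1" using assms(1-3) by (metis One_nat_def Suc_leI card_gt_0_iff empty_iff)
  have "card (\<chi> ` (e - {v})) = r - 1"
    using assms by (simp add: card_image card_Diff_singleton)
  then obtain k where k: "k \<in> {..<r}" "k \<notin> \<chi> ` (e - {v})" "\<chi> ` (e - {v}) = {..<r} - {k}"
    using subset_eq_Diff_singleton[of "{..<r}" "\<chi> ` (e - {v})" r] assms(5) r by auto
  have "bij_betw f e {..<r} \<longleftrightarrow> f v = k" if f: "\<And>x. x \<in> e - {v} \<Longrightarrow> f x = \<chi> x" for f
  proof -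
    have im: "f ` (e - {v}) = {..<r} - {k}" using k(3) f by (metis image_cong)
    have e: "insert v (e - {v}) = e" using assms(3) by blast
    have inj: "inj_on f (e - {v})" using assms(4) f by (metis inj_on_cong)
    show ?thesis
    proof
      assume "bij_betw f e {..<r}"
      then have "f v \<in> {..<r}" "f v \<notin> f ` (e - {v})"
        using assms(3) by (auto simp: bij_betw_def inj_on_def)
      then show "f v = k" using im by blast
    next
      assume "f v = k"
      have "f ` e = insert (f v) (f ` (e - {v}))" by (subst e[symmetric]) (rule image_insert)
      moreover have "inj_on f (insert v (e - {v}))"
        unfolding inj_on_insert using inj im \<open>f v = k\<close> by auto
      then have "inj_on f e" by (simp only: e)
      ultimately show "bij_betw f e {..<r}"
        using im k(1) \<open>f v = k\<close> by (auto simp: bij_betw_def)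
    qed
  qed
  then show thesis using that k(1) by blast
qed

lemma tight_orderingE:
  assumes "tight_ordering T es" "1 \<le> i" "i < length es"
  obtains v s where "v \<in> es ! i" "s < i" "v \<notin> (\<Union>j<i. es ! j)" "es ! i - {v} \<subseteq> es ! s"
  using assms unfolding tight_ordering_def by blast

text \<open>The first edge supplies \<open>r\<close> vertices and each later edge exactly one
  more.\<close>

lemma card_tight_prefix:
  assumes ord: "tight_ordering T es" and T: "\<And>e. e \<in> T \<Longrightarrow> finite e \<and> card e = r"
    and "r \<ge> 1" "1 \<le> k" "k \<le> length es"
  shows "card (\<Union>j<k. es ! j) = r + k - 1"
  using assms(4,5)
proof (induction k rule: dec_induct)
  case base
  then have "0 < length es" by linarith
  then have "es ! 0 \<in> T" using ord nth_mem by (metis tight_ordering_def)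
  then show ?case using T by (simp add: lessThan_Suc)
next
  case (step k)
  obtain v s where vs: "v \<in> es ! k" "s < k" "v \<notin> (\<Union>j<k. es ! j)" "es ! k - {v} \<subseteq> es ! s"
    using tight_orderingE[OF ord, of k] step by auto
  have "es ! s \<subseteq> (\<Union>j<k. es ! j)" using vs(2) by blast
  then have "(\<Union>j<Suc k. es ! j) = insert v (\<Union>j<k. es ! j)"
    using vs(1,4) by (simp add: lessThan_Suc) blast
  moreover have "finite (\<Union>j<k. es ! j)"
    using T ord step by (auto simp: tight_ordering_def)
  ultimately show ?case using vs(3) step assms(3) by simp
qed

text \<open>Along the ordering, each later edge has a single new vertex, whose other
  \<open>r - 1\<close> companions lie in one earlier edge and so have distinct colours; the new
  vertex takes the missing one.\<close>

lemma tight_colouring: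
  assumes ord: "tight_ordering T es" and T: "\<And>e. e \<in> T \<Longrightarrow> finite e \<and> card e = r"
  shows "\<exists>\<chi>. \<forall>e\<in>T. bij_betw \<chi> e {..<r}"
proof -
  have nth: "finite (es ! i)" "card (es ! i) = r" if "i < length es" for i
    using T ord that by (auto simp: tight_ordering_def)
  have "\<exists>\<chi>. \<forall>i<k. bij_betw \<chi> (es ! i) {..<r}" if "k \<le> length es" for k
    using that
  proof (induction k)
    case (Suc k)
    then obtain \<chi> where \<chi>: "\<And>i. i < k \<Longrightarrow> bij_betw \<chi> (es ! i) {..<r}" by auto
    show ?case
    proof (cases "k = 0")
      case True
      have "\<exists>\<chi>. bij_betw \<chi> (es ! 0) {..<r}"
        using nth[of 0] Suc.prems True finite_same_card_bij[of "es ! 0" "{..<r}"]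
        by (cases es) auto
      then show ?thesis using True by auto
    next
      case False
      then obtain v s where vs: "v \<in> es ! k" "s < k" "v \<notin> (\<Union>j<k. es ! j)" "es ! k - {v} \<subseteq> es ! s"
        using tight_orderingE[OF ord, of k] Suc.prems by auto
      have "inj_on \<chi> (es ! k - {v})" "\<chi> ` (es ! k - {v}) \<subseteq> {..<r}"
        using \<chi>[OF vs(2)] vs(4) by (auto simp: bij_betw_def intro: inj_on_subset)
      then obtain c where c: "\<And>f. (\<And>x. x \<in> es ! k - {v} \<Longrightarrow> f x = \<chi> x) \<Longrightarrow>
          bij_betw f (es ! k) {..<r} \<longleftrightarrow> f v = c"
        using missing_colour[of "es ! k" r v \<chi>] nth[of k] vs(1) Suc.prems
        by (metis Suc_le_lessD)
      have "bij_betw (\<chi>(v := c)) (es ! i) {..<r}" if "i < Suc k" for i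
      proof (cases "i = k")
        case True
        then show ?thesis using c[of "\<chi>(v := c)"] by simp
      next
        case False
        then have "i < k" using that by simp
        then have "v \<notin> es ! i" using vs(3) by auto
        then have "bij_betw (\<chi>(v := c)) (es ! i) {..<r} \<longleftrightarrow> bij_betw \<chi> (es ! i) {..<r}"
          by (intro bij_betw_cong) auto
        then show ?thesis using \<chi>[OF \<open>i < k\<close>] by simp
      qed
      then show ?thesis by blast
    qed
  qed simp
  from this[of "length es"] show ?thesis
    using ord by (metis order_refl in_set_conv_nth tight_ordering_def)
qed

text \<open>Edges are added in order, codegree \<open>c\<close> leaving room for each new vertex;
  colours then match automatically. Allowing any proper \<open>\<chi>\<close> is what later permits
  a free matching of colour classes to ranks.\<close>

lemma tight_prefix_embedding:
  assumes ord: "tight_ordering T es" and T: "\<And>e. e \<in> T \<Longrightarrow> finite e \<and> card e = r"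
    and \<chi>: "\<And>e. e \<in> T \<Longrightarrow> bij_betw \<chi> e {..<r::nat}"
    and H: "\<And>h. h \<in> H \<Longrightarrow> finite h \<and> card h = r \<and> bij_betw col h {..<r}"
    and "finite H" "H \<noteq> {}" "r \<ge> 1"
    and dense: "\<And>S. S \<in> shadow r H \<Longrightarrow> codegree H S \<ge> c"
    and "c \<le> length es"
  shows "\<exists>f. inj_on f (\<Union>j<c. es ! j) \<and> (\<forall>j<c. f ` (es ! j) \<in> H) \<and>
    (\<forall>v\<in>(\<Union>j<c. es ! j). col (f v) = \<chi> v)"
proof -
  have nthT: "es ! i \<in> T" if "i < length es" for i
    using ord that by (auto simp: tight_ordering_def)
  note nth = T[OF nthT] \<chi>[OF nthT]
  have "\<exists>f. inj_on f (\<Union>j<k. es ! j) \<and> (\<forall>j<k. f ` (es ! j) \<in> H) \<and>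
    (\<forall>v\<in>(\<Union>j<k. es ! j). col (f v) = \<chi> v)" if "k \<le> c" for k
    using that
  proof (induction k)
    case (Suc k)
    let ?U = "\<Union>j<k. es ! j"
    have k: "k < length es" using Suc.prems assms(9) by simp
    obtain f where f: "inj_on f ?U" "\<And>j. j < k \<Longrightarrow> f ` (es ! j) \<in> H"
      "\<And>v. v \<in> ?U \<Longrightarrow> col (f v) = \<chi> v"
      using Suc by auto
    show ?case
    proof (cases "k = 0")
      \<comment> \<open>No growth condition applies to index 0, so the first edge goes onto any edge
        of \<open>H\<close>, matched by colour.\<close>
      case True
      obtain h where h: "h \<in> H" using \<open>H \<noteq> {}\<close> by blast
      have "bij_betw (inv_into h col \<circ> \<chi>) (es ! 0) h"
        using nth(2)[of 0] k bij_betw_inv_into H[OF h] True by (metis bij_betw_trans)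
      moreover have "col ((inv_into h col \<circ> \<chi>) v) = \<chi> v" if "v \<in> es ! 0" for v
        using bij_betw_inv_into_right[of col h "{..<r}" "\<chi> v"] H[OF h] nth(2)[of 0] k True
          bij_betwE that by (metis comp_apply)
      ultimately show ?thesis using True h
        by (intro exI[of _ "inv_into h col \<circ> \<chi>"]) (simp add: bij_betw_def lessThan_Suc comp_def)
    next
      case False
      then obtain v s where vs: "v \<in> es ! k" "s < k" "v \<notin> ?U" "es ! k - {v} \<subseteq> es ! s"
        using tight_orderingE[OF ord, of k] k by auto
      define F where "F = es ! k - {v}"
      have FU: "F \<subseteq> ?U" using vs by (auto simp: F_def)
      have cF: "card F = r - 1" using nth(1)[OF k] vs(1) by (simp add: F_def)
      have cfF: "card (f ` F) = r - 1" using cF card_image inj_on_subset[OF f(1) FU] by metis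
      have finU: "finite ?U" using nth(1) k by auto
      have "f ` F \<in> shadow r H"
        using f(2)[OF vs(2)] vs(4) cfF by (auto simp: shadow_def F_def)
      then have deg: "codegree H (f ` F) \<ge> c" by (rule dense)
      \<comment> \<open>Of the \<open>r + k - 1\<close> vertices used so far, \<open>r - 1\<close>
        lie in \<open>f\<close> F\<open>, so only\<close>k <
        c\<open>can block an extension of\<close>f \<open>F\<close>.\<close>
      have "card (f ` ?U - f ` F) = card (f ` ?U) - card (f ` F)"
        using FU finU finite_subset[OF FU] by (intro card_Diff_subset finite_imageI image_mono)
      also have "card (f ` ?U) = r + k - 1"
        using card_image[OF f(1)] card_tight_prefix[OF ord T, of k] False k \<open>r \<ge> 1\<close> by simp
      finally have lt: "card (f ` ?U - f ` F) < c" using cfF Suc.prems \<open>r \<ge> 1\<close> by simp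
      have "\<exists>w. w \<notin> f ` ?U \<and> insert w (f ` F) \<in> H"
      proof (rule ccontr)
        assume no: "\<nexists>w. w \<notin> f ` ?U \<and> insert w (f ` F) \<in> H"
        have "{h \<in> H. f ` F \<subseteq> h} \<subseteq> (\<lambda>w. insert w (f ` F)) ` (f ` ?U - f ` F)"
        proof
          fix h assume "h \<in> {h \<in> H. f ` F \<subseteq> h}"
          then have h: "h \<in> H" "f ` F \<subseteq> h" by auto
          obtain w where w: "w \<in> h" "w \<notin> f ` F" "f ` F = h - {w}"
            using subset_eq_Diff_singleton[of h "f ` F" r] H[OF h(1)] h(2) cfF \<open>r \<ge> 1\<close> by metis
          then have "h = insert w (f ` F)" by auto
          moreover from this have "w \<in> f ` ?U" using no h(1) by metis
          ultimately show "h \<in> (\<lambda>w. insert w (f ` F)) ` (f ` ?U - f ` F)" using w(2) by blast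
        qed
        then have "codegree H (f ` F) \<le> card (f ` ?U - f ` F)"
          unfolding codegree_def using finU by (intro surj_card_le) auto
        then show False using deg lt by simp
      qed
      then obtain w where w: "w \<notin> f ` ?U" "insert w (f ` F) \<in> H" by blast
      define g where "g = f(v := w)"
      have gU: "g u = f u" if "u \<in> ?U" for u using vs(3) that by (auto simp: g_def)
      have U': "(\<Union>j<Suc k. es ! j) = insert v ?U"
        using vs(1) FU by (simp add: lessThan_Suc F_def) blast
      have gk: "g ` (es ! k) = insert w (f ` F)"
      proof -
        have "es ! k = insert v F" using vs(1) by (auto simp: F_def)
        moreover have "g ` F = f ` F" by (rule image_cong[OF refl gU]) (use FU in blast)
        moreover have "g v = w" by (simp add: g_def)
        ultimately show ?thesis by (simp only: image_insert)
      qed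
      have gH: "g ` (es ! j) \<in> H" if "j < Suc k" for j
      proof (cases "j = k")
        case False
        then have "j < k" using that by simp
        moreover from this have "g ` (es ! j) = f ` (es ! j)" using gU by (intro image_cong) auto
        ultimately show ?thesis using f(2) by simp
      qed (use gk w in auto)
      have inj: "inj_on g (insert v ?U)"
        using f(1) w(1) vs(3) gU inj_on_cong[of ?U g f] by (auto simp: g_def)
      have "inj_on \<chi> F" "\<chi> ` F \<subseteq> {..<r}"
        using nth(2)[OF k] by (auto simp: bij_betw_def F_def intro: inj_on_subset)
      then obtain m where m: "\<And>p. (\<And>x. x \<in> F \<Longrightarrow> p x = \<chi> x) \<Longrightarrow>
          bij_betw p (es ! k) {..<r} \<longleftrightarrow> p v = m"
        using missing_colour[of "es ! k" r v \<chi>] nth(1)[OF k] vs(1) unfolding F_def by metis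
      have "es ! k \<subseteq> insert v ?U" using FU by (auto simp: F_def)
      then have "bij_betw g (es ! k) (g ` (es ! k))"
        using inj_on_subset[OF inj] by (intro bij_betw_imageI refl)
      \<comment> \<open>Both \<open>col \<circ> g\<close> and \<open>\<chi>\<close> are bijective on
        the new edge and agree on \<open>F\<close>, so both give \<open>v\<close> the one missing
        colour.\<close>
      then have "bij_betw (col \<circ> g) (es ! k) {..<r}"
        using H[OF gH[of k]] bij_betw_trans by blast
      moreover have "(col \<circ> g) x = \<chi> x" if "x \<in> F" for x
        using gU f(3) subsetD[OF FU that] by simp
      ultimately have "col (g v) = \<chi> v"
        using m[of "col \<circ> g"] m[of \<chi>] nth(2)[OF k] by (metis comp_apply)
      then have "col (g u) = \<chi> u" if "u \<in> insert v ?U" for u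
      proof (cases "u = v")
        case False
        then have "u \<in> ?U" using that by blast
        then show ?thesis using gU f(3) by metis
      qed simp
      then show ?thesis using inj gH unfolding U' by blast
    qed
  qed simp
  then show ?thesis by blast
qed

section \<open>Leaves attached to the trunk\<close>

text \<open>The ordering gives each edge outside the trunk a new vertex, and the trunk condition
  gives it a neighbour \<open>p e\<close> in the trunk; comparing sizes shows that the two meet in
  exactly \<open>e - {v e}\<close>. Newness makes \<open>v\<close> injective.\<close>

lemma trunk_leaves:
  assumes "trunk r T T'" and T: "\<And>e. e \<in> T \<Longrightarrow> finite e \<and> card e = r" and "r \<ge> 1"
  obtains es v p where "tight_ordering T es" "set (take (card T') es) = T'"
    "inj_on v (T - T')"
    "\<And>e. e \<in> T - T' \<Longrightarrow> v e \<in> e \<and> v e \<notin> \<Union>T' \<and> p e \<in> T' \<and> e - {v e} \<subseteq> p e"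
proof -
  obtain es where ord: "tight_ordering T es" and T': "set (take (card T') es) = T'"
    using assms(1) by (auto simp: trunk_def)
  have sub: "T' \<subseteq> T" "T' \<noteq> {}" and near: "\<And>e. e \<in> T - T' \<Longrightarrow> \<exists>e'\<in>T'. card (e \<inter> e') = r - 1"
    using assms(1) by (auto simp: trunk_def tight_tree_def)
  have es: "distinct es" "set es = T" using ord by (auto simp: tight_ordering_def)
  have finT: "finite T" using es(2) by blast
  have c: "1 \<le> card T'" "card T' \<le> length es"
    using sub finT card_mono[OF finT sub(1)] es
    by (auto simp: distinct_card[symmetric] Suc_le_eq card_gt_0_iff intro: finite_subset)
  have ex: "\<exists>i v p. i < length es \<and> e = es ! i \<and> v \<in> e \<and> v \<notin> (\<Union>j<i. es ! j) \<and> v \<notin> \<Union>T' \<and>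
      p \<in> T' \<and> e - {v} \<subseteq> p" if e: "e \<in> T - T'" for e
  proof -
    obtain i where i: "i < length es" "e = es ! i" using e es(2) by (metis DiffD1 in_set_conv_nth)
    \<comment> \<open>The trunk fills the first \<open>card T'\<close> positions, so the new vertex
      of \<open>e\<close> avoids the whole trunk.\<close>
    have ic: "card T' \<le> i"
    proof (rule ccontr)
      assume "\<not> card T' \<le> i"
      then have "e \<in> set (take (card T') es)" using i by (auto simp: in_set_conv_nth)
      then show False using e T' by simp
    qed
    obtain v s where v: "v \<in> es ! i" "v \<notin> (\<Union>j<i. es ! j)"
      using tight_orderingE[OF ord _ i(1)] ic c by (metis le_trans)
    have vT': "v \<notin> \<Union>T'"
    proof
      assume "v \<in> \<Union>T'"
      then obtain e' where "e' \<in> set (take (card T') es)" "v \<in> e'" using T' by auto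
      then obtain j where "j < card T'" "v \<in> es ! j" by (auto simp: in_set_conv_nth)
      then show False using v(2) ic by auto
    qed
    obtain p where p: "p \<in> T'" "card (e \<inter> p) = r - 1" using near[OF e] by blast
    have "e \<inter> p \<subseteq> e - {v}" using vT' p(1) by auto
    moreover have "card (e - {v}) = r - 1" using T[of e] e v(1) i by simp
    ultimately have "e \<inter> p = e - {v}"
      using p(2) T[of e] e by (intro card_subset_eq) auto
    then show ?thesis using i v vT' p(1) by blast
  qed
  then obtain i v p where ivp: "\<And>e. e \<in> T - T' \<Longrightarrow> i e < length es \<and> e = es ! (i e) \<and> v e \<in> e \<and>
      v e \<notin> (\<Union>j<i e. es ! j) \<and> v e \<notin> \<Union>T' \<and> p e \<in> T' \<and> e - {v e} \<subseteq> p e"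
    by metis
  have new: "v e \<noteq> v e'" if "e \<in> T - T'" "e' \<in> T - T'" "i e < i e'" for e e'
    using ivp[OF that(1)] ivp[OF that(2)] that(3) by (metis UN_I lessThan_iff)
  have "inj_on v (T - T')"
  proof (rule inj_onI)
    fix e e' assume e: "e \<in> T - T'" "e' \<in> T - T'" "v e = v e'"
    then have "i e = i e'" using new by (metis linorder_neqE_nat)
    then show "e = e'" using ivp e by metis
  qed
  then show thesis using that[OF ord T'] ivp by blast
qed

lemma contains_of_large_leaf_sets:
  assumes Ts: "\<And>e. e \<in> T \<Longrightarrow> finite e \<and> card e = r" and "r \<ge> 1" and "finite T" and "T' \<subseteq> T"
    and v: "inj_on v (T - T')"
      "\<And>e. e \<in> T - T' \<Longrightarrow> v e \<in> e \<and> v e \<notin> \<Union>T' \<and> e - {v e} \<subseteq> \<Union>T'"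
    and G: "r_graph r V E"
    and f: "inj_on f (\<Union>T')" "\<And>e. e \<in> T' \<Longrightarrow> f ` e \<in> E"
    and cT': "card (\<Union>T') = r + c - 1"
    and deg: "\<And>e. e \<in> T - T' \<Longrightarrow>
      codegree E (f ` (e - {v e})) \<ge> card {e' \<in> T - T'. key e' \<le> (key e :: nat)} + c"
  shows "contains V E T"
proof -
  have E: "\<And>e. e \<in> E \<Longrightarrow> e \<subseteq> V \<and> finite e \<and> card e = r" and finV: "finite V"
    using G by (auto simp: r_graph_def intro: finite_subset)
  have finT': "finite (\<Union>T')" using Ts assms(3,4) by (meson finite_Union finite_subset subsetD)
  define A where "A e = {w. insert w (f ` (e - {v e})) \<in> E} - f ` \<Union>T'" for e
  have A: "finite (A e) \<and> card {e' \<in> T - T'. key e' \<le> key e} \<le> card (A e)" if e: "e \<in> T - T'" for e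
  proof -
    define F where "F = f ` (e - {v e})"
    have cF: "card F = r - 1"
      unfolding F_def using Ts[of e] v(2)[OF e] e inj_on_subset[OF f(1)] by (subst card_image) auto
    have finF: "finite F" using Ts[of e] e by (auto simp: F_def)
    define N where "N = {w. w \<notin> F \<and> insert w F \<in> E}"
    have finN: "finite {w. insert w F \<in> E}"
      using E by (intro finite_subset[OF _ finV]) auto
    have "{h \<in> E. F \<subseteq> h} \<subseteq> (\<lambda>w. insert w F) ` N"
    proof
      fix h assume "h \<in> {h \<in> E. F \<subseteq> h}"
      then have h: "h \<in> E" "F \<subseteq> h" by auto
      obtain w where w: "w \<in> h" "w \<notin> F" "F = h - {w}"
        using subset_eq_Diff_singleton[of h F r] E[OF h(1)] h(2) cF \<open>r \<ge> 1\<close> by metis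
      then have "h = insert w F" by auto
      then show "h \<in> (\<lambda>w. insert w F) ` N" using w(2) h(1) by (auto simp: N_def)
    qed
    then have "codegree E F \<le> card N"
      unfolding codegree_def using finN by (intro surj_card_le) (auto simp: N_def)
    moreover have "A e = {w. insert w F \<in> E} - f ` \<Union>T'" by (simp add: A_def F_def)
    moreover have FT': "F \<subseteq> f ` \<Union>T'" using v(2)[OF e] by (auto simp: F_def)
    ultimately have Ae: "A e = N - (f ` \<Union>T' - F)" "codegree E F \<le> card N" by (auto simp: N_def)
    have "card (f ` \<Union>T' - F) = card (f ` \<Union>T') - card F"
      using FT' finF by (intro card_Diff_subset) auto
    also have "\<dots> = c" using cF cT' card_image[OF f(1)] \<open>r \<ge> 1\<close> by simp
    finally have "card N - c \<le> card (A e)"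
      using diff_card_le_card_Diff[of "f ` \<Union>T' - F" N] finT' Ae(1) by simp
    then show ?thesis
      using deg[OF e] Ae(2) finN by (auto simp: A_def F_def)
  qed
  obtain g where g: "inj_on g (T - T')" "\<And>e. e \<in> T - T' \<Longrightarrow> g e \<in> A e"
    using greedy_choice[of "T - T'" A key] A assms(3) by blast
  \<comment> \<open>\<open>inv_into\<close> recovers the leaf edge from its new vertex; values off
    \<open>\<Union>T\<close> do not matter.\<close>
  define \<phi> where "\<phi> u = (if u \<in> \<Union>T' then f u else g (inv_into (T - T') v u))" for u
  have \<phi>T': "\<phi> u = f u" if "u \<in> \<Union>T'" for u using that by (simp add: \<phi>_def)
  have \<phi>v: "\<phi> (v e) = g e" if "e \<in> T - T'" for e
    using that v by (simp add: \<phi>_def inv_into_f_f)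
  have UT: "\<Union>T = \<Union>T' \<union> v ` (T - T')" using v(2) \<open>T' \<subseteq> T\<close> by blast
  have "inj_on \<phi> (\<Union>T' \<union> v ` (T - T'))"
  proof -
    have "inj_on \<phi> (\<Union>T')" using f(1) \<phi>T' by (metis inj_on_cong)
    moreover have "inj_on \<phi> (v ` (T - T'))"
      using \<phi>v g(1) by (auto simp: inj_on_def)
    moreover have "\<phi> u \<noteq> \<phi> w" if u: "u \<in> \<Union>T'" and w: "w \<in> v ` (T - T')" for u w
    proof -
      obtain e where e: "e \<in> T - T'" "w = v e" using w by blast
      have "g e \<notin> f ` \<Union>T'" using g(2)[OF e(1)] by (simp add: A_def)
      then show ?thesis using u \<phi>T'[OF u] \<phi>v[OF e(1)] e(2) by (metis imageI)
    qed
    ultimately show ?thesis unfolding inj_on_Un by blast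
  qed
  moreover have \<phi>E: "\<phi> ` e \<in> E" if "e \<in> T" for e
  proof (cases "e \<in> T'")
    case True
    then have "\<phi> ` e = f ` e" using \<phi>T' by (intro image_cong) auto
    then show ?thesis using f(2) True by simp
  next
    case False
    then have e: "e \<in> T - T'" using that by simp
    have "\<phi> ` e = insert (\<phi> (v e)) (\<phi> ` (e - {v e}))" using v(2)[OF e] by blast
    also have "\<phi> ` (e - {v e}) = f ` (e - {v e})"
      by (rule image_cong[OF refl \<phi>T']) (use v(2)[OF e] in blast)
    finally show ?thesis using g(2)[OF e] \<phi>v[OF e] by (simp add: A_def)
  qed
  moreover have "\<phi> ` \<Union>T \<subseteq> V" using \<phi>E E by blast
  ultimately show ?thesis unfolding contains_def UT by blast
qed

section \<open>Counting light edges and matching colour classes to ranks\<close>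

text \<open>Contrapositive form for an arbitrary trunk with its exact size; passing to an upper
  bound on that size is then pure monotonicity.\<close>

lemma contains_of_many_edges:
  assumes "r \<ge> 2" and T: "tight_tree r T" and tr: "trunk r T T'" and G: "r_graph r V E"
    and large: "real (card E) > ((real (card T) - 1) / real r + a_const r (card T')) *
      real (card (shadow r E))"
  shows "contains V E T"
proof -
  define t c where "t = card T" and "c = card T'"
  \<comment> \<open>This equals \<open>(t - c) / r + (c - 1)\<close>: the average number of leaves
    per colour class, plus room for the trunk. Adding \<open>r ^ r * (c - 1)\<close> gives the
    coefficient in \<open>large\<close>.\<close>
  define \<beta> where "\<beta> = (real t - 1) / real r + (1 - 1 / real r) * (real c - 1)"
  have r: "r \<ge> 1" using \<open>r \<ge> 2\<close> by simp
  have Ts: "\<And>e. e \<in> T \<Longrightarrow> finite e \<and> card e = r"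
    using T by (auto simp: tight_tree_def r_graph_def intro: finite_subset)
  have E: "\<And>e. e \<in> E \<Longrightarrow> e \<subseteq> V \<and> finite e \<and> card e = r" and finV: "finite V"
    using G by (auto simp: r_graph_def intro: finite_subset)
  note finE = r_graph_finite[OF G]
  have finT: "finite T" using T by (auto simp: tight_tree_def tight_ordering_def)
  have T': "T' \<subseteq> T" "T' \<noteq> {}" using tr by (auto simp: trunk_def tight_tree_def)
  have c: "1 \<le> c" "c \<le> t"
    using T' finT card_mono[OF finT T'(1)]
    by (auto simp: t_def c_def Suc_le_eq card_gt_0_iff intro: finite_subset)
  have \<beta>: "\<beta> \<ge> 0" using c r unfolding \<beta>_def by (intro add_nonneg_nonneg mult_nonneg_nonneg) auto
  let ?w = "\<lambda>e. \<Sum>x\<in>e. 1 / real (codegree E (e - {x}))"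
  define L where "L = {e \<in> E. \<beta> * ?w e < 1}"
  have finL: "finite L" using finE by (simp add: L_def)
  \<comment> \<open>Markov's inequality: each heavy edge has \<open>\<beta>\<close> times its weight
    at least 1, while the total weight is at most the size of the shadow.\<close>
  have "real (card (E - L)) \<le> (\<Sum>e\<in>E - L. \<beta> * ?w e)"
    using sum_bounded_below[of "E - L" 1 "\<lambda>e. \<beta> * ?w e"] by (auto simp: L_def not_less)
  also have "\<dots> \<le> (\<Sum>e\<in>E. \<beta> * ?w e)"
    using finE \<beta> by (intro sum_mono2 mult_nonneg_nonneg sum_nonneg) auto
  also have "\<dots> = \<beta> * (\<Sum>e\<in>E. ?w e)" by (simp add: sum_distrib_left)
  also have "\<dots> \<le> \<beta> * real (card (shadow r E))"
    by (rule mult_left_mono[OF sum_inverse_codegree_le[OF G r] \<beta>])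
  finally have heavy: "real (card (E - L)) \<le> \<beta> * real (card (shadow r E))" .
  have "card E = card L + card (E - L)"
    using finE card_Un_disjoint[of L "E - L"] finL by (simp add: L_def Un_absorb1 subset_iff)
  moreover have "(real t - 1) / real r + a_const r c = \<beta> + real r ^ r * (real c - 1)"
    by (simp add: \<beta>_def a_const_def algebra_simps)
  then have "(\<beta> + real r ^ r * (real c - 1)) * real (card (shadow r E)) < real (card E)"
    using large by (simp add: t_def c_def)
  ultimately have "real r ^ r * (real c - 1) * real (card (shadow r E)) < real (card L)"
    using heavy by (simp add: distrib_right)
  then have "real (r ^ r * ((c - 1) * card (shadow r E))) < real (card L)"
    using c by (simp add: of_nat_diff mult.assoc)
  then have light: "r ^ r * ((c - 1) * card (shadow r E)) < card L" by linarith
  have "\<exists>\<tau>. bij_betw \<tau> e {..<r} \<and> (\<forall>x\<in>e. (real (\<tau> x) + 1) * \<beta> < real (codegree E (e - {x})))"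
    if "e \<in> L" for e
    using that E \<beta> codegree_pos[OF finE(1)] by (intro light_edge_labelling) (auto simp: L_def)
  then obtain \<tau> where \<tau>: "\<And>e. e \<in> L \<Longrightarrow> bij_betw (\<tau> e) e {..<r}"
    "\<And>e x. e \<in> L \<Longrightarrow> x \<in> e \<Longrightarrow> (real (\<tau> e x) + 1) * \<beta> < real (codegree E (e - {x}))"
    by metis
  obtain col where col: "card L \<le> r ^ r * card {e \<in> L. \<forall>v\<in>e. col v = \<tau> e v}"
    using exists_agreeing_colouring[OF finV finL, of r \<tau>] E \<tau>(1) r
    by (metis (no_types, lifting) L_def bij_betw_imp_surj_on mem_Collect_eq order_refl)
  define H0 where "H0 = {e \<in> L. \<forall>v\<in>e. col v = \<tau> e v}"
  have H0: "H0 \<subseteq> E" "finite H0" using finL by (auto simp: H0_def) (simp add: L_def)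
  have "r ^ r * ((c - 1) * card (shadow r E)) < r ^ r * card H0"
    using less_le_trans[OF light col] by (simp only: H0_def)
  then have "(c - 1) * card (shadow r E) < card H0" by simp
  moreover have sh: "shadow r H0 \<subseteq> shadow r E" by (rule shadow_mono[OF H0(1)])
  ultimately have dense: "(c - 1) * card (shadow r H0) < card H0"
    using card_mono[OF finE(2) sh] by (meson le_less_trans mult_le_mono2)
  obtain H where H: "H \<subseteq> H0" "H \<noteq> {}" "\<And>S. S \<in> shadow r H \<Longrightarrow> codegree H S > c - 1"
    using exists_dense_subgraph[OF H0(2) finite_subset[OF sh finE(2)] dense] by metis
  have Hcol: "bij_betw col h {..<r}" if "h \<in> H" for h
  proof -
    have "h \<in> L" "\<And>v. v \<in> h \<Longrightarrow> col v = \<tau> h v" using that H(1) by (auto simp: H0_def)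
    then show ?thesis using \<tau>(1)[of h] by (metis bij_betw_cong)
  qed
  \<comment> \<open>These codegrees are taken in \<open>E\<close>, which supplies the leaves;
    codegrees inside \<open>H\<close> serve only to embed the trunk.\<close>
  have Hdeg: "(real (col x) + 1) * \<beta> < real (codegree E (h - {x}))" if "h \<in> H" "x \<in> h" for h x
    using that H(1) \<tau>(2)[of h x] by (auto simp: H0_def)
  obtain es v p where ord: "tight_ordering T es" and esT': "set (take c es) = T'"
    and v: "inj_on v (T - T')"
      "\<And>e. e \<in> T - T' \<Longrightarrow> v e \<in> e \<and> v e \<notin> \<Union>T' \<and> p e \<in> T' \<and> e - {v e} \<subseteq> p e"
    using trunk_leaves[OF tr Ts r] unfolding c_def by metis
  have len: "c \<le> length es"
    using c ord by (simp add: t_def tight_ordering_def distinct_card[symmetric])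
  have UT': "(\<Union>j<c. es ! j) = \<Union>T'"
    using len nth_image[of c es] esT' by (simp add: lessThan_atLeast0)
  obtain \<chi>0 where \<chi>0: "\<And>e. e \<in> T \<Longrightarrow> bij_betw \<chi>0 e {..<r}"
    using tight_colouring[OF ord Ts] by blast
  define M where "M = T - T'"
  have finM: "finite M" using finT by (simp add: M_def)
  have cM: "card M = t - c" using T' finT by (simp add: M_def t_def c_def card_Diff_subset finite_subset)
  define n0 where "n0 i = card {e \<in> M. \<chi>0 (v e) = i}" for i
  \<comment> \<open>Renaming the colours by \<open>\<sigma>\<close> makes class sizes nondecreasing,
    so classes with few leaves meet the ranks with the weakest codegree bounds.\<close>
  obtain \<sigma> where \<sigma>: "bij_betw \<sigma> {..<r} {..<r}"
    and \<sigma>mono: "\<And>i j. i < r \<Longrightarrow> j < r \<Longrightarrow> \<sigma> i \<le> \<sigma> j \<Longrightarrow> n0 i \<le> n0 j"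
    using exists_sorting_bij[of "{..<r}" n0] by auto
  define \<chi> where "\<chi> = \<sigma> \<circ> \<chi>0"
  have \<chi>: "bij_betw \<chi> e {..<r}" if "e \<in> T" for e
    unfolding \<chi>_def using bij_betw_trans[OF \<chi>0[OF that] \<sigma>] .
  define n where "n i = card {e \<in> M. \<chi> (v e) = i}" for i
  have vlt: "\<chi>0 (v e) < r" "\<chi> (v e) < r" if "e \<in> M" for e
    using that v(2) bij_betwE[OF \<chi>0] bij_betwE[OF \<chi>] by (auto simp: M_def)
  have n\<sigma>: "n (\<sigma> i) = n0 i" if "i < r" for i
  proof -
    have "\<sigma> (\<chi>0 (v e)) = \<sigma> i \<longleftrightarrow> \<chi>0 (v e) = i" if "e \<in> M" for e
      using \<sigma> vlt(1)[OF that] \<open>i < r\<close> by (auto simp: bij_betw_def inj_on_def)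
    then have "{e \<in> M. \<chi> (v e) = \<sigma> i} = {e \<in> M. \<chi>0 (v e) = i}" by (auto simp: \<chi>_def)
    then show ?thesis by (simp add: n_def n0_def)
  qed
  have nmono: "n i \<le> n j" if "i \<le> j" "j < r" for i j
  proof -
    have "i \<in> \<sigma> ` {..<r}" "j \<in> \<sigma> ` {..<r}" using \<sigma> that by (auto simp: bij_betw_def)
    then obtain a b where "a < r" "\<sigma> a = i" "b < r" "\<sigma> b = j" by blast
    then show ?thesis using n\<sigma>[of a] n\<sigma>[of b] \<sigma>mono[of a b] that(1) by simp
  qed
  have nprefix: "card {e \<in> M. \<chi> (v e) \<le> i} = (\<Sum>j\<le>i. n j)" for i
    unfolding n_def using finM
    by (subst card_UN_disjoint[symmetric]) (auto intro: arg_cong[where f = card])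
  have nsum: "(\<Sum>j<r. n j) = t - c"
    unfolding n_def cM[symmetric] using finM vlt(2)
    by (subst card_UN_disjoint[symmetric]) (auto intro: arg_cong[where f = card])
  have HE: "finite h \<and> card h = r \<and> bij_betw col h {..<r}" if "h \<in> H" for h
    using that E H(1) H0(1) Hcol by blast
  have Hc: "codegree H S \<ge> c" if "S \<in> shadow r H" for S
    using H(3)[OF that] by linarith
  obtain f where f: "inj_on f (\<Union>T')" "\<And>j. j < c \<Longrightarrow> f ` (es ! j) \<in> H"
      "\<And>u. u \<in> \<Union>T' \<Longrightarrow> col (f u) = \<chi> u"
    using tight_prefix_embedding[OF ord Ts \<chi> HE finite_subset[OF H(1) H0(2)] H(2) r Hc len]
    unfolding UT' by metis
  have fH: "f ` e \<in> H" if "e \<in> T'" for e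
    using that f(2) esT' len by (metis in_set_conv_nth length_take min.absorb2 nth_take)
  have deg: "codegree E (f ` (e - {v e})) \<ge> card {e' \<in> T - T'. \<chi> (v e') \<le> \<chi> (v e)} + c"
    if e: "e \<in> T - T'" for e
  proof -
    define i where "i = \<chi> (v e)"
    have ve: "v e \<in> e" "v e \<notin> \<Union>T'" "p e \<in> T'" "e - {v e} \<subseteq> p e" using v(2)[OF e] by auto
    have pT: "p e \<in> T" using ve(3) T' by blast
    \<comment> \<open>The vertex \<open>y\<close> is the one that \<open>v e\<close> replaces in
      \<open>p e\<close>. The shared \<open>r - 1\<close> vertices force both to have colour
      \<open>i\<close>, so the codegree bound of rank \<open>i\<close> applies opposite
      \<open>f y\<close>.\<close>
    obtain y where y: "y \<in> p e" "y \<notin> e - {v e}" "e - {v e} = p e - {y}"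
      using subset_eq_Diff_singleton[of "p e" "e - {v e}" r] Ts[OF pT] Ts[of e] e ve r
      by (metis DiffD1 card_Diff_singleton)
    have "\<chi> ` (a - {x}) = {..<r} - {\<chi> x}" if "a \<in> T" "x \<in> a" for a x
      using inj_on_image_set_diff[of \<chi> a a "{x}"] \<chi>[OF that(1)] that(2)
      by (simp add: bij_betw_def)
    then have "\<chi> ` (p e - {y}) = {..<r} - {\<chi> y}" "\<chi> ` (e - {v e}) = {..<r} - {\<chi> (v e)}"
      using pT e y(1) ve(1) by blast+
    moreover have "\<chi> y < r" using bij_betwE[OF \<chi>[OF pT]] y(1) by auto
    ultimately have \<chi>y: "\<chi> y = i" using y(3) unfolding i_def
      by (metis Diff_iff empty_iff insert_iff lessThan_iff)
    have "f ` (p e - {y}) = f ` p e - f ` {y}"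
      using y(1) ve(3) by (intro inj_on_image_set_diff[OF f(1)]) auto
    then have "f ` (e - {v e}) = f ` p e - {f y}" using y(3) by simp
    moreover have "col (f y) = i" using f(3) y(1) ve(3) \<chi>y by auto
    ultimately have d: "(real i + 1) * \<beta> < real (codegree E (f ` (e - {v e})))"
      using Hdeg[OF fH[OF ve(3)], of "f y"] y(1) by simp
    have "i < r" unfolding i_def using vlt(2) e by (simp add: M_def)
    then have "r * (\<Sum>j\<le>i. n j) \<le> (i + 1) * (t - c)"
      using sum_prefix_le_average[of r n i] nmono nsum by simp
    then have "real r * real (\<Sum>j\<le>i. n j) \<le> (real i + 1) * (real t - real c)"
      using c by (metis of_nat_1 of_nat_add of_nat_diff of_nat_le_iff of_nat_mult)
    then have "real (\<Sum>j\<le>i. n j) \<le> (real i + 1) * ((real t - real c) / real r)"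
      using r by (simp add: field_simps)
    also have "\<dots> = (real i + 1) * \<beta> - (real i + 1) * (real c - 1)"
      using r by (simp add: \<beta>_def field_simps)
    \<comment> \<open>Of the reserve \<open>(i + 1) * (c - 1)\<close>, a single \<open>c - 1\<close>
      is kept; by integrality, the strict bound on the codegree provides the remaining 1 of the
      required \<open>c\<close>.\<close>
    also have "\<dots> \<le> (real i + 1) * \<beta> - (real c - 1)"
      using c mult_right_mono[of 1 "real i + 1" "real c - 1"] by simp
    finally have "real (\<Sum>j\<le>i. n j) + real c - 1 < real (codegree E (f ` (e - {v e})))"
      using d by simp
    then have "real ((\<Sum>j\<le>i. n j) + c) < real (codegree E (f ` (e - {v e})) + 1)"
      unfolding of_nat_add of_nat_1 by linarith
    then have "(\<Sum>j\<le>i. n j) + c < codegree E (f ` (e - {v e})) + 1"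
      by (simp only: of_nat_less_iff)
    then show ?thesis using nprefix[of i] by (simp add: i_def M_def)
  qed
  show ?thesis
  proof (rule contains_of_large_leaf_sets[OF Ts r finT T'(1) v(1) _ G f(1) _ _ deg])
    show "card (\<Union>T') = r + c - 1"
      using card_tight_prefix[OF ord Ts r c(1) len] UT' by simp
  qed (use v(2) fH H(1) H0(1) in blast)+
qed

theorem theorem1:
  fixes r t c :: nat
    and T :: "'b set set"
    and V :: "'a set"
    and E :: "'a set set"
  assumes "r \<ge> 2" and "c \<ge> 1" and "t \<ge> c"
    and "tight_tree r T" and "card T = t" and "trunk_number r T \<le> c"
    and "r_graph r V E" and "\<not> contains V E T"
  shows "real (card E) \<le> ((real t - 1) / real r + a_const r c) * real (card (shadow r E))"
proof -
  \<comment> \<open>The least value is attained because \<open>T\<close> is a trunk of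
    itself.\<close>
  have "\<exists>T'. trunk r T T' \<and> card T' = trunk_number r T"
    unfolding trunk_number_def by (rule LeastI_ex) (use trunk_self[OF assms(4)] in blast)
  then obtain T' where T': "trunk r T T'" "card T' \<le> c" using assms(6) by auto
  have "real (card E) \<le> ((real t - 1) / real r + a_const r (card T')) * real (card (shadow r E))"
    using contains_of_many_edges[OF assms(1,4) T'(1) assms(7)] assms(5,8) by (meson not_less)
  also have "a_const r (card T') \<le> a_const r c"
  proof -
    have "1 / real r \<le> 1" using assms(1) by simp
    then have "real r ^ r + 1 - 1 / real r \<ge> 0" using zero_le_power[of "real r" r] by linarith
    then show ?thesis unfolding a_const_def using T'(2) by (intro mult_left_mono) auto
  qed
  then have "((real t - 1) / real r + a_const r (card T')) * real (card (shadow r E)) \<le>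
      ((real t - 1) / real r + a_const r c) * real (card (shadow r E))"
    by (intro mult_right_mono) auto
  finally show ?thesis .
qed

end
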